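(* Let $\Gamma=\mathrm{OSC}(G,R,L,S)$ be an oriented semi-Cayley graph over an abelian group $G$ of order $n$. Let $$X=\{k\in G:\chi_k(S)=0\}.$$ Let $g,h\in G$, let $\alpha,\beta$ be nonzero real numbers and let $t\in\mathbb{R}$. Then $\Gamma$ admits $(\alpha,\beta)$-FR from $u=(g,0)$ to $v=(h,1)$ at time $t$ if and only if all the following conditions hold: (a) $X=\emptyset$; (b) Setting $a=g^{-1}h$, for every $k\in G$, $$\exp\left(t\lambda_k^+\right)=\alpha+\beta\, c_k^{-}\left(\overline{e_k^+}\right)^{-1}\overline{\chi_k(a)},\qquad \exp\left(t\lambda_k^-\right)=\alpha-\beta\, c_k^{+}\left(\overline{e_k^+}\right)^{-1}\overline{\chi_k(a)}.$$
   Context: An oriented graph $\Gamma$ is a finite graph with edge set $E(\Gamma)\subseteq V(\Gamma)\times V(\Gamma)$ such that $(u,v)\in E(\Gamma)$ implies $(v,u)\notin E(\Gamma)$. Its adjacency matrix $A_\Gamma=[a_{uv}]$ has $a_{uv}=1$ if $(u,v)\in E(\Gamma)$, $a_{uv}=-1$ if $(v,u)\in E(\Gamma)$, and $0$ otherwise. The transition matrix is $U(t)=\exp(A_\Gamma t)$, $t\in\mathbb{R}$. $\mathbf{e}_u$ is the standard basis vector indexed by $u$. Fractional revival: for distinct vertices $u,v$ and real $\alpha,\beta$ with $\alpha^2+\beta^2=1$, $\beta\neq0$, $\Gamma$ admits $(\alpha,\beta)$-FR from $u$ to $v$ at time $t$ if $U(t)\mathbf{e}_u=\alpha\mathbf{e}_u+\beta\mathbf{e}_v$.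 Oriented semi-Cayley graph: let $G$ be a finite group with identity $e$ and let $R,L,S\subseteq G$ satisfy $R\cap R^{-1}=L\cap L^{-1}=\emptyset$ and $e\notin R\cup L$. $\mathrm{OSC}(G,R,L,S)$ is the oriented graph with vertex set $\{(g,0),(g,1)\mid g\in G\}$ and directed edges $((g,0),(h,0))$ with $g^{-1}h\in R$; $((g,1),(h,1))$ with $g^{-1}h\in L$; and $((g,0),(h,1))$ with $g^{-1}h\in S$. Characters: write the finite abelian group as $G=\mathbb{Z}_{n_1}\oplus\cdots\oplus\mathbb{Z}_{n_p}$. For $z=(z_1,\dots,z_p)\in G$, $\chi_z(g)=\prod_{s=1}^p\omega_{n_s}^{z_sg_s}$ for $g=(g_1,\dots,g_p)\in G$, where $\omega_{n_s}=\exp(2\pi\mathrm{i}/n_s)$. For $T\subseteq G$, $\chi_z(T)=\sum_{x\in T}\chi_z(x)$. The group operation is also written multiplicatively. For $k\in G$ put $r_k=\chi_k(R)-\chi_k(R^{-1})$, $l_k=\chi_k(L)-\chi_k(L^{-1})$, $$A_k=\begin{pmatrix} r_k & \chi_k(S)\\ -\overline{\chi_k(S)} & l_k\end{pmatrix},\qquad \lambda_k^{\pm}=\frac12\left(r_k+l_k\pm\mathrm{i}\left|\sqrt{(l_k-r_k)^2-4|\chi_k(S)|^2}\right|\right).$$ Here $(l_k-r_k)^2-4|\chi_k(S)|^2\le 0$, and $\lambda_k^\pm$ are the eigenvalues of $A_k$. Let $v_k^\pm=(a_k^\pm,b_k^\pm)^{\mathsf T}$ be normalized eigenvectors of $A_k$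 for $\lambda_k^\pm$; if $\chi_k(S)=0$, the convention is $\lambda_k^+=r_k$, $\lambda_k^-=l_k$, $v_k^+=(1,0)^{\mathsf T}$, $v_k^-=(0,1)^{\mathsf T}$. Define $c_k^\pm=|a_k^\pm|^2$, $d_k^\pm=|b_k^\pm|^2$, $e_k^\pm=a_k^\pm\overline{b_k^\pm}$. When $\chi_k(S)\neq 0$ one has $e_k^+\neq0$. *)

theory Defs
  imports
    "HOL-Analysis.Analysis"
    "HOL-Algebra.Elementary_Groups"
    "HOL-Algebra.Product_Groups"
    "Graph_Theory.Pair_Digraph"
begin

locale oriented_graph = pair_fin_digraph +
  assumes no_reverse_arc: "(u, v) \<in> parcs G \<Longrightarrow> (v, u) \<notin> parcs G"

definition adj_matrix :: "'v pair_pre_digraph \<Rightarrow> 'v \<Rightarrow> 'v \<Rightarrow> real" where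
  "adj_matrix \<Gamma> u v =
     (if (u, v) \<in> parcs \<Gamma> then 1 else if (v, u) \<in> parcs \<Gamma> then -1 else 0)"

text \<open>
  A matrix whose rows and columns are indexed by a finite set \<open>V\<close> is a function of two
  arguments, of which only the values on \<open>V\<close> matter. Its exponential is taken entrywise
  from the power series.
\<close>

primrec matrix_pow :: "'v set \<Rightarrow> ('v \<Rightarrow> 'v \<Rightarrow> real) \<Rightarrow> nat \<Rightarrow> 'v \<Rightarrow> 'v \<Rightarrow> real" where
  "matrix_pow V M 0 = (\<lambda>u v. if u = v then 1 else 0)"
| "matrix_pow V M (Suc j) = (\<lambda>u v. \<Sum>w\<in>V. M u w * matrix_pow V M j w v)"

definition matrix_exp :: "'v set \<Rightarrow> ('v \<Rightarrow> 'v \<Rightarrow> real) \<Rightarrow> 'v \<Rightarrow> 'v \<Rightarrow> real" where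
  "matrix_exp V M u v = (\<Sum>j. matrix_pow V M j u v / fact j)"

definition matrix_apply :: "'v set \<Rightarrow> ('v \<Rightarrow> 'v \<Rightarrow> real) \<Rightarrow> ('v \<Rightarrow> real) \<Rightarrow> 'v \<Rightarrow> real" where
  "matrix_apply V M x u = (\<Sum>v\<in>V. M u v * x v)"

definition unit_vector :: "'v \<Rightarrow> 'v \<Rightarrow> real" where
  "unit_vector u w = (if w = u then 1 else 0)"

definition transition_matrix :: "'v pair_pre_digraph \<Rightarrow> real \<Rightarrow> 'v \<Rightarrow> 'v \<Rightarrow> real" where
  "transition_matrix \<Gamma> t = matrix_exp (pverts \<Gamma>) (\<lambda>u v. adj_matrix \<Gamma> u v * t)"

definition admits_FR ::
  "'v pair_pre_digraph \<Rightarrow> real \<Rightarrow> real \<Rightarrow> 'v \<Rightarrow> 'v \<Rightarrow> real \<Rightarrow> bool" where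
  "admits_FR \<Gamma> \<alpha> \<beta> u v t \<longleftrightarrow>
     u \<in> pverts \<Gamma> \<and> v \<in> pverts \<Gamma> \<and> u \<noteq> v \<and> \<alpha>\<^sup>2 + \<beta>\<^sup>2 = 1 \<and> \<beta> \<noteq> 0 \<and>
     (\<forall>w\<in>pverts \<Gamma>. matrix_apply (pverts \<Gamma>) (transition_matrix \<Gamma> t) (unit_vector u) w =
        \<alpha> * unit_vector u w + \<beta> * unit_vector v w)"

definition osc_graph ::
  "('a, 'b) monoid_scheme \<Rightarrow> 'a set \<Rightarrow> 'a set \<Rightarrow> 'a set \<Rightarrow> ('a \<times> nat) pair_pre_digraph" where
  "osc_graph G R L S =
     \<lparr> pverts = carrier G \<times> {0, 1},
       parcs =
         {((g, 0), (h, 0)) | g h. g \<in> carrier G \<and> h \<in> carrier G \<and> inv\<^bsub>G\<^esub> g \<otimes>\<^bsub>G\<^esub> h \<in> R} \<union>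
         {((g, 1), (h, 1)) | g h. g \<in> carrier G \<and> h \<in> carrier G \<and> inv\<^bsub>G\<^esub> g \<otimes>\<^bsub>G\<^esub> h \<in> L} \<union>
         {((g, 0), (h, 1)) | g h. g \<in> carrier G \<and> h \<in> carrier G \<and> inv\<^bsub>G\<^esub> g \<otimes>\<^bsub>G\<^esub> h \<in> S} \<rparr>"

lemma osc_graph_oriented:
  fixes G (structure)
  assumes "group G" "finite (carrier G)"
    and "R \<inter> set_inv R = {}" "L \<inter> set_inv L = {}"
  shows "oriented_graph (osc_graph G R L S)"
proof -
  interpret group G by fact
  have inv_diff: "inv h \<otimes> g = inv (inv g \<otimes> h)" if "g \<in> carrier G" "h \<in> carrier G" for g h
    using that by (simp add: inv_mult_group)
  have no_reverse: "inv h \<otimes> g \<notin> T"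
    if "T \<inter> set_inv T = {}" "g \<in> carrier G" "h \<in> carrier G" "inv g \<otimes> h \<in> T" for T g h
    using that inv_diff[OF that(2,3)] by (auto simp: SET_INV_def)
  have fin: "finite (parcs (osc_graph G R L S))"
    by (rule finite_subset[where B = "(carrier G \<times> {0, 1}) \<times> (carrier G \<times> {0, 1})"])
       (use assms(2) in \<open>auto simp: osc_graph_def\<close>)
  show ?thesis
    by unfold_locales
       (use fin assms(2) no_reverse[OF assms(3)] no_reverse[OF assms(4)] in
         \<open>auto simp: osc_graph_def\<close>)
qed

text \<open>
  \<open>cyclic_sum_group p m\<close> is the direct sum of the cyclic groups of orders \<open>m 1, \<dots>, m p\<close>; the
  orders must be positive, since \<open>integer_mod_group 0\<close> is the group of all integers.
  An abstract abelian group is identified with such a sum by an isomorphism \<open>\<phi>\<close>, through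
  which its elements also serve as labels of its characters.
\<close>

definition cyclic_sum_group :: "nat \<Rightarrow> (nat \<Rightarrow> nat) \<Rightarrow> (nat \<Rightarrow> int) monoid" where
  "cyclic_sum_group p m = product_group {1..p} (\<lambda>s. integer_mod_group (m s))"

definition root_of_unity :: "nat \<Rightarrow> complex" where
  "root_of_unity N = exp (2 * of_real pi * \<i> / of_nat N)"

definition grp_char ::
  "nat \<Rightarrow> (nat \<Rightarrow> nat) \<Rightarrow> ('a \<Rightarrow> nat \<Rightarrow> int) \<Rightarrow> 'a \<Rightarrow> 'a \<Rightarrow> complex" where
  "grp_char p m \<phi> z g = (\<Prod>s=1..p. root_of_unity (m s) powi (\<phi> z s * \<phi> g s))"

text \<open>In the following, \<open>\<psi>\<close> is a single character of \<open>G\<close>.\<close>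

definition char_sum :: "('a \<Rightarrow> complex) \<Rightarrow> 'a set \<Rightarrow> complex" where
  "char_sum \<psi> T = (\<Sum>x\<in>T. \<psi> x)"

definition skew_char_sum ::
  "('a, 'b) monoid_scheme \<Rightarrow> ('a \<Rightarrow> complex) \<Rightarrow> 'a set \<Rightarrow> complex" where
  "skew_char_sum G \<psi> T = char_sum \<psi> T - char_sum \<psi> (set_inv\<^bsub>G\<^esub> T)"

definition osc_block ::
  "('a, 'b) monoid_scheme \<Rightarrow> 'a set \<Rightarrow> 'a set \<Rightarrow> 'a set \<Rightarrow> ('a \<Rightarrow> complex) \<Rightarrow> complex^2^2" where
  "osc_block G R L S \<psi> =
     vector [vector [skew_char_sum G \<psi> R, char_sum \<psi> S],
             vector [- cnj (char_sum \<psi> S), skew_char_sum G \<psi> L]]"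

definition osc_gap ::
  "('a, 'b) monoid_scheme \<Rightarrow> 'a set \<Rightarrow> 'a set \<Rightarrow> 'a set \<Rightarrow> ('a \<Rightarrow> complex) \<Rightarrow> real" where
  "osc_gap G R L S \<psi> =
     cmod (csqrt ((skew_char_sum G \<psi> L - skew_char_sum G \<psi> R)\<^sup>2
                   - 4 * of_real ((cmod (char_sum \<psi> S))\<^sup>2)))"

text \<open>
  If the character sum over \<open>S\<close> vanishes, the two eigenvalues are labelled by their position
  on the diagonal, which may differ from the order the general formula would give.
\<close>

definition osc_lambda_plus ::
  "('a, 'b) monoid_scheme \<Rightarrow> 'a set \<Rightarrow> 'a set \<Rightarrow> 'a set \<Rightarrow> ('a \<Rightarrow> complex) \<Rightarrow> complex" where
  "osc_lambda_plus G R L S \<psi> =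
     (if char_sum \<psi> S = 0 then skew_char_sum G \<psi> R
      else (skew_char_sum G \<psi> R + skew_char_sum G \<psi> L + \<i> * of_real (osc_gap G R L S \<psi>)) / 2)"

definition osc_lambda_minus ::
  "('a, 'b) monoid_scheme \<Rightarrow> 'a set \<Rightarrow> 'a set \<Rightarrow> 'a set \<Rightarrow> ('a \<Rightarrow> complex) \<Rightarrow> complex" where
  "osc_lambda_minus G R L S \<psi> =
     (if char_sum \<psi> S = 0 then skew_char_sum G \<psi> L
      else (skew_char_sum G \<psi> R + skew_char_sum G \<psi> L - \<i> * of_real (osc_gap G R L S \<psi>)) / 2)"

definition normalized_eigenvector :: "complex^2^2 \<Rightarrow> complex \<Rightarrow> complex^2 \<Rightarrow> bool" where
  "normalized_eigenvector M \<mu> x \<longleftrightarrow> norm x = 1 \<and> M *v x = \<mu> *s x"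

definition eig_c :: "complex^2 \<Rightarrow> real" where
  "eig_c x = (cmod (x $ 1))\<^sup>2"

definition eig_e :: "complex^2 \<Rightarrow> complex" where
  "eig_e x = x $ 1 * cnj (x $ 2)"

end

theory Submission
  imports Defs
begin

text \<open>
  If \<open>\<psi>\<close> is a character and \<open>y\<close> an eigenvector of its \<open>2 \<times> 2\<close> block, then \<open>\<psi> \<otimes> y\<close> is an
  eigenvector of the adjacency matrix; as that matrix is real and skew-symmetric with an imaginary
  eigenvalue \<open>\<lambda>\<close>, the conjugate of \<open>\<psi> \<otimes> y\<close> is a left eigenvector of \<open>U(t)\<close> for \<open>exp (t \<lambda>)\<close>.
  These left eigenvectors span the space, so fractional revival is equivalent to its pairings with
  them, which read \<open>exp (t \<lambda>) cnj y\<^sub>1 = \<alpha> cnj y\<^sub>1 + \<beta> cnj y\<^sub>2 cnj (\<psi> a)\<close>. A block with vanishing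
  off-diagonal entry has the eigenvector \<open>(0, 1)\<close>, which would force \<open>\<beta> = 0\<close>. For the other blocks
  the orthonormality of the two eigenvectors turns the pairings into condition (b), and summing the
  squared moduli of both pairings gives \<open>\<alpha>\<^sup>2 + \<beta>\<^sup>2 = 1\<close>.
\<close>

section \<open>Exponentials of matrices over a finite index set\<close>

text \<open>The sum of all absolute entries dominates every absolute row sum, so each multiplication
  by \<open>M\<close> costs at most this factor. The bound is crude but geometric, which is enough
  for convergence of the exponential series.\<close>

lemma matrix_pow_bound:
  assumes "finite V" "u \<in> V"
  shows "\<bar>matrix_pow V M j u v\<bar> \<le> (\<Sum>x\<in>V. \<Sum>y\<in>V. \<bar>M x y\<bar>) ^ j"
  using assms(2)
proof (induction j arbitrary: u)
  case 0
  show ?case by simp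
next
  case (Suc j)
  let ?C = "\<Sum>x\<in>V. \<Sum>y\<in>V. \<bar>M x y\<bar>"
  have "\<bar>matrix_pow V M (Suc j) u v\<bar> \<le> (\<Sum>w\<in>V. \<bar>M u w\<bar> * \<bar>matrix_pow V M j w v\<bar>)"
    by (simp add: sum_abs[THEN order_trans] abs_mult)
  also have "\<dots> \<le> (\<Sum>w\<in>V. \<bar>M u w\<bar> * ?C ^ j)"
    by (intro sum_mono mult_left_mono Suc.IH) auto
  also have "\<dots> = (\<Sum>w\<in>V. \<bar>M u w\<bar>) * ?C ^ j"
    by (simp add: sum_distrib_right)
  also have "\<dots> \<le> ?C * ?C ^ j"
    using assms(1) Suc.prems
    by (intro mult_right_mono member_le_sum zero_le_power sum_nonneg) auto
  finally show ?case by simp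
qed

text \<open>\<open>matrix_exp\<close> is an infinite sum, informative only where the series
  converges. Here it is compared with the series of the real exponential at
  \<open>?C\<close>.\<close>

lemma matrix_exp_sums:
  assumes "finite V" "u \<in> V"
  shows "(\<lambda>j. matrix_pow V M j u v / fact j) sums matrix_exp V M u v"
proof -
  let ?C = "\<Sum>x\<in>V. \<Sum>y\<in>V. \<bar>M x y\<bar>"
  have "summable (\<lambda>j. ?C ^ j / fact j)"
    using summable_exp[of ?C] by (simp add: field_simps)
  then have "summable (\<lambda>j. matrix_pow V M j u v / fact j)"
    by (rule summable_comparison_test')
       (use matrix_pow_bound[OF assms] in \<open>auto simp: divide_right_mono\<close>)
  then show ?thesis
    by (simp add: matrix_exp_def summable_sums)
qed

text \<open>\<open>matrix_pow\<close> attaches each new factor \<open>M\<close> on the left, where a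
  left eigenvector absorbs it at once. Left eigenvectors are the right tool because revival concerns
  a column of \<open>U(t)\<close>, which they test by pairing.\<close>

lemma left_eigenvector_matrix_pow:
  fixes l :: "'v \<Rightarrow> complex"
  assumes "finite V" "u \<in> V"
    and eig: "\<And>w. w \<in> V \<Longrightarrow> (\<Sum>x\<in>V. l x * of_real (M x w)) = \<mu> * l w"
  shows "(\<Sum>x\<in>V. l x * of_real (matrix_pow V M j x u)) = \<mu> ^ j * l u"
proof (induction j)
  case 0
  have "(\<Sum>x\<in>V. l x * of_real (if x = u then 1 else 0)) = (\<Sum>x\<in>V. if x = u then l x else 0)"
    by (intro sum.cong) auto
  then show ?case using assms(1,2) by simp
next
  case (Suc j)
  have "(\<Sum>x\<in>V. l x * of_real (matrix_pow V M (Suc j) x u))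
      = (\<Sum>x\<in>V. \<Sum>w\<in>V. l x * of_real (M x w) * of_real (matrix_pow V M j w u))"
    by (simp add: sum_distrib_left mult.assoc)
  also have "\<dots> = (\<Sum>w\<in>V. (\<Sum>x\<in>V. l x * of_real (M x w)) * of_real (matrix_pow V M j w u))"
    by (subst sum.swap) (simp add: sum_distrib_right)
  also have "\<dots> = \<mu> * (\<Sum>w\<in>V. l w * of_real (matrix_pow V M j w u))"
    by (simp add: eig sum_distrib_left mult.assoc)
  finally show ?case by (simp add: Suc.IH)
qed

text \<open>Pairing with \<open>l\<close> is a finite sum, so it passes through the series and turns
  it term by term into the series of \<open>exp \<mu>\<close>, scaled by \<open>l u\<close>.\<close>

lemma left_eigenvector_matrix_exp:
  fixes l :: "'v \<Rightarrow> complex"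
  assumes "finite V" "u \<in> V"
    and eig: "\<And>w. w \<in> V \<Longrightarrow> (\<Sum>x\<in>V. l x * of_real (M x w)) = \<mu> * l w"
  shows "(\<Sum>x\<in>V. l x * of_real (matrix_exp V M x u)) = exp \<mu> * l u"
proof -
  have "(\<lambda>j. \<Sum>x\<in>V. l x * of_real (matrix_pow V M j x u / fact j)) sums
      (\<Sum>x\<in>V. l x * of_real (matrix_exp V M x u))"
    by (intro sums_sum sums_mult sums_of_real matrix_exp_sums assms)
  moreover have "(\<Sum>x\<in>V. l x * of_real (matrix_pow V M j x u / fact j)) = (\<mu> ^ j /\<^sub>R fact j) * l u" for j
    using arg_cong[OF left_eigenvector_matrix_pow[of V u l M \<mu> j, OF assms], of "\<lambda>z. z / fact j"]
    by (simp add: sum_divide_distrib scaleR_conv_of_real field_simps)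
  moreover have "(\<lambda>j. (\<mu> ^ j /\<^sub>R fact j) * l u) sums (exp \<mu> * l u)"
    by (intro sums_mult2 exp_converges)
  ultimately show ?thesis by (simp add: sums_unique2)
qed

lemma matrix_apply_unit_vector:
  assumes "finite V" "u \<in> V"
  shows "matrix_apply V M (unit_vector u) w = M w u"
proof -
  have "(\<Sum>v\<in>V. M w v * unit_vector u v) = (\<Sum>v\<in>V. if v = u then M w v else 0)"
    by (intro sum.cong) (auto simp: unit_vector_def)
  then show ?thesis using assms by (simp add: matrix_apply_def)
qed

section \<open>Characters\<close>

text \<open>The whole block analysis rests on these properties of a single character, so the cyclic
  coordinates stay out of it.\<close>

locale unitary_character = group G for G :: "('a, 'b) monoid_scheme" (structure) +
  fixes \<psi> :: "'a \<Rightarrow> complex"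
  assumes finite_carrier: "finite (carrier G)"
    and norm_char: "x \<in> carrier G \<Longrightarrow> cmod (\<psi> x) = 1"
    and char_mult: "x \<in> carrier G \<Longrightarrow> y \<in> carrier G \<Longrightarrow> \<psi> (x \<otimes> y) = \<psi> x * \<psi> y"
begin

lemma cnj_char_mult: "x \<in> carrier G \<Longrightarrow> cnj (\<psi> x) * \<psi> x = 1"
  using norm_char[of x] complex_norm_square[of "\<psi> x"] by (simp add: mult.commute)

lemma char_nonzero: "x \<in> carrier G \<Longrightarrow> \<psi> x \<noteq> 0"
  using norm_char by fastforce

lemma char_one: "\<psi> \<one> = 1"
  using char_mult[of \<one> \<one>] char_nonzero[of \<one>] by simp

lemma char_inv: "x \<in> carrier G \<Longrightarrow> \<psi> (inv x) = cnj (\<psi> x)"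
  using char_mult[of "inv x" x] cnj_char_mult[of x] char_nonzero[of x] char_one
  by (metis inv_closed l_inv mult_right_cancel)

text \<open>Applied to \<open>R\<close> and \<open>L\<close> this makes the diagonal block entries
  purely imaginary; applied to \<open>S\<close> it produces the lower left entry.\<close>

lemma char_sum_set_inv:
  assumes "T \<subseteq> carrier G"
  shows "char_sum \<psi> (set_inv T) = cnj (char_sum \<psi> T)"
proof -
  have "set_inv T = m_inv G ` T" by (auto simp: SET_INV_def)
  moreover have "inj_on (m_inv G) T" using assms by (meson inj_onI inv_inj inj_on_subset)
  ultimately have "char_sum \<psi> (set_inv T) = (\<Sum>x\<in>T. \<psi> (inv x))"
    by (simp add: char_sum_def sum.reindex)
  also have "\<dots> = (\<Sum>x\<in>T. cnj (\<psi> x))"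
    using assms by (intro sum.cong) (auto simp: char_inv)
  finally show ?thesis by (simp add: char_sum_def)
qed

lemma cnj_skew_char_sum:
  "T \<subseteq> carrier G \<Longrightarrow> cnj (skew_char_sum G \<psi> T) = - skew_char_sum G \<psi> T"
  by (simp add: skew_char_sum_def char_sum_set_inv)

text \<open>Substituting \<open>h = g \<otimes> x\<close> pulls out \<open>\<psi> g\<close>. This is
  why a character is an eigenvector of every Cayley-type matrix, with the character sum as
  eigenvalue.\<close>

lemma sum_translate_char:
  assumes "T \<subseteq> carrier G" "g \<in> carrier G"
  shows "(\<Sum>h\<in>carrier G. of_bool (inv g \<otimes> h \<in> T) * \<psi> h) = \<psi> g * char_sum \<psi> T"
proof -
  have "(\<Sum>h\<in>carrier G. of_bool (inv g \<otimes> h \<in> T) * \<psi> h)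
      = (\<Sum>x\<in>carrier G. of_bool (inv g \<otimes> (g \<otimes> x) \<in> T) * \<psi> (g \<otimes> x))"
    using assms(2) surj_const_mult[OF assms(2)] inj_on_cmult[OF assms(2)]
    by (intro sum.reindex_cong[where l = "\<lambda>x. g \<otimes> x"]) auto
  also have "\<dots> = (\<Sum>x\<in>carrier G. \<psi> g * (of_bool (x \<in> T) * \<psi> x))"
    using assms(2) by (intro sum.cong) (auto simp: char_mult m_assoc[symmetric])
  also have "\<dots> = \<psi> g * (\<Sum>x\<in>carrier G. if x \<in> T then \<psi> x else 0)"
    unfolding sum_distrib_left by (intro sum.cong) auto
  also have "(\<Sum>x\<in>carrier G. if x \<in> T then \<psi> x else 0) = char_sum \<psi> T"
    using assms(1) finite_carrier
    by (simp add: char_sum_def sum.inter_restrict[symmetric] Int_absorb1)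
  finally show ?thesis .
qed

end

section \<open>Powers of roots of unity\<close>

lemma root_of_unity_powi: "root_of_unity N powi k = exp (\<i> * of_real (2 * pi * of_int k / real N))"
  by (simp add: root_of_unity_def exp_power_int field_simps)

lemma norm_root_of_unity_powi: "cmod (root_of_unity N powi k) = 1"
  unfolding root_of_unity_powi by (rule norm_exp_i_times)

lemma root_of_unity_powi_eq_1:
  assumes "N \<ge> 1"
  shows "root_of_unity N powi k = 1 \<longleftrightarrow> int N dvd k"
proof -
  have "root_of_unity N powi k = 1 \<longleftrightarrow> (\<exists>j::int. real_of_int k = real_of_int (int N * j))"
    using assms by (simp add: root_of_unity_powi exp_eq_1 field_simps)
  then show ?thesis by (simp only: of_int_eq_iff dvd_def)
qed

text \<open>Coordinates in the cyclic sum are reduced modulo the orders after each multiplication;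
  this lets the exponents ignore the reduction.\<close>

lemma root_of_unity_powi_cong:
  assumes "N \<ge> 1" "j mod int N = k mod int N"
  shows "root_of_unity N powi j = root_of_unity N powi k"
proof -
  have "root_of_unity N \<noteq> 0" by (simp add: root_of_unity_def)
  moreover have "root_of_unity N powi (j - k) = 1"
    using assms by (simp add: root_of_unity_powi_eq_1 mod_eq_dvd_iff)
  ultimately show ?thesis by (simp add: power_int_diff)
qed

text \<open>The symmetry between label and argument lets a sum over labels be treated as a sum of
  one character over the group.\<close>

lemma grp_char_commute: "grp_char p m \<phi> z g = grp_char p m \<phi> g z"
  by (simp add: grp_char_def mult.commute)

section \<open>Orthogonality of characters and Fourier inversion\<close>

locale cyclic_decomposition = comm_group G for G :: "('a, 'b) monoid_scheme" (structure) +
  fixes p :: nat and m :: "nat \<Rightarrow> nat" and \<phi> :: "'a \<Rightarrow> nat \<Rightarrow> int"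
  assumes finite_carrier: "finite (carrier G)"
    and orders_pos: "s \<in> {1..p} \<Longrightarrow> m s \<ge> 1"
    and iso_cyclic_sum: "\<phi> \<in> iso G (cyclic_sum_group p m)"
begin

lemma coordinate_mult:
  assumes "x \<in> carrier G" "y \<in> carrier G" "s \<in> {1..p}"
  shows "\<phi> (x \<otimes> y) s = (\<phi> x s + \<phi> y s) mod int (m s)"
proof -
  have "\<phi> (x \<otimes> y) = \<phi> x \<otimes>\<^bsub>cyclic_sum_group p m\<^esub> \<phi> y"
    using iso_cyclic_sum assms(1,2) by (simp add: iso_def hom_mult)
  then show ?thesis using assms(3) by (simp add: cyclic_sum_group_def)
qed

lemma bij_coordinates:
  "bij_betw \<phi> (carrier G) (\<Pi>\<^sub>E s\<in>{1..p}. carrier (integer_mod_group (m s)))"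
  using iso_cyclic_sum by (simp add: iso_def cyclic_sum_group_def)

lemma unitary_character_grp_char: "unitary_character G (grp_char p m \<phi> z)"
proof unfold_locales
  show "cmod (grp_char p m \<phi> z x) = 1" for x
    by (simp add: grp_char_def prod_norm[symmetric] norm_root_of_unity_powi)
next
  fix x y assume xy: "x \<in> carrier G" "y \<in> carrier G"
  have "root_of_unity (m s) powi (\<phi> z s * \<phi> (x \<otimes> y) s)
      = root_of_unity (m s) powi (\<phi> z s * \<phi> x s) * root_of_unity (m s) powi (\<phi> z s * \<phi> y s)"
    if s: "s \<in> {1..p}" for s
  proof -
    have "root_of_unity (m s) powi (\<phi> z s * \<phi> (x \<otimes> y) s)
        = root_of_unity (m s) powi (\<phi> z s * \<phi> x s + \<phi> z s * \<phi> y s)"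
      using orders_pos[OF s] coordinate_mult[OF xy s]
      by (intro root_of_unity_powi_cong) (simp_all add: mod_mult_right_eq distrib_left)
    then show ?thesis by (simp add: power_int_add root_of_unity_def)
  qed
  then show "grp_char p m \<phi> z (x \<otimes> y) = grp_char p m \<phi> z x * grp_char p m \<phi> z y"
    by (simp add: grp_char_def prod.distrib)
qed (rule finite_carrier)

text \<open>Some coordinate \<open>s\<close> of \<open>x\<close> is nonzero. The element with
  coordinate 1 at \<open>s\<close> and 0 elsewhere picks out a power of the root of unity with
  exponent strictly between 0 and \<open>m s\<close>, hence different from 1.\<close>

lemma grp_char_separates:
  assumes x: "x \<in> carrier G" "x \<noteq> \<one>"
  shows "\<exists>z\<in>carrier G. grp_char p m \<phi> x z \<noteq> 1"
proof -
  \<comment> \<open>Since the identity is idempotent, its coordinate is congruent to its own double,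
    so \<open>m s\<close> divides a number in the range from 0 to \<open>m s - 1\<close>.\<close>
  have one: "\<phi> \<one> s = 0" if "s \<in> {1..p}" for s
  proof -
    have "\<phi> \<one> \<in> (\<Pi>\<^sub>E s\<in>{1..p}. carrier (integer_mod_group (m s)))"
      using bij_coordinates by (auto simp: bij_betw_def)
    then have "\<phi> \<one> s \<in> carrier (integer_mod_group (m s))" using that by (rule PiE_mem)
    then have range: "0 \<le> \<phi> \<one> s" "\<phi> \<one> s < int (m s)"
      using orders_pos[OF that] by (simp_all add: carrier_integer_mod_group)
    then have "(\<phi> \<one> s + \<phi> \<one> s) mod int (m s) = \<phi> \<one> s mod int (m s)"
      using coordinate_mult[of \<one> \<one> s] that by simp
    then have "int (m s) dvd \<phi> \<one> s" by (simp add: mod_eq_dvd_iff)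
    then have "\<not> 0 < \<phi> \<one> s" using range zdvd_not_zless by blast
    then show ?thesis using range by simp
  qed
  have mem: "\<phi> y \<in> (\<Pi>\<^sub>E s\<in>{1..p}. carrier (integer_mod_group (m s)))" if "y \<in> carrier G" for y
    using bij_coordinates that by (auto simp: bij_betw_def)
  obtain s where s: "s \<in> {1..p}" "\<phi> x s \<noteq> 0"
  proof -
    have "\<phi> x \<noteq> \<phi> \<one>"
      using bij_coordinates x by (metis bij_betw_imp_inj_on inj_on_eq_iff one_closed)
    then show ?thesis
      using mem[OF x(1)] mem[OF one_closed] one that by (metis PiE_ext)
  qed
  have range: "\<phi> x s \<in> {0..<int (m s)}"
    using PiE_mem[OF mem[OF x(1)] s(1)] orders_pos[OF s(1)]
    by (auto simp: carrier_integer_mod_group split: if_splits)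
  define c where "c = (\<lambda>i\<in>{1..p}. if i = s then 1 else 0 :: int)"
  \<comment> \<open>The entry 1 at \<open>s\<close> is a legal residue because
    \<open>0 < \<phi> x s < m s\<close> forces \<open>m s\<close> to be at least 2.\<close>
  have "c \<in> (\<Pi>\<^sub>E s\<in>{1..p}. carrier (integer_mod_group (m s)))"
    using orders_pos s(2) range by (auto simp: c_def carrier_integer_mod_group)
  then obtain z where z: "z \<in> carrier G" "\<phi> z = c"
    using bij_coordinates by (metis bij_betw_iff_bijections)
  have "grp_char p m \<phi> x z = (\<Prod>i=1..p. if i = s then root_of_unity (m s) powi \<phi> x s else 1)"
    unfolding grp_char_def z(2) c_def by (intro prod.cong) auto
  also have "\<dots> = root_of_unity (m s) powi \<phi> x s" using s(1) by simp
  also have "\<dots> \<noteq> 1"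
    using orders_pos[OF s(1)] range s(2) zdvd_imp_le by (fastforce simp: root_of_unity_powi_eq_1)
  finally show ?thesis using z(1) by blast
qed

text \<open>For nontrivial \<open>x\<close>, translating the summation variable by some
  \<open>y\<close> with character value different from 1 multiplies the sum by that value, so the
  sum vanishes.\<close>

lemma sum_grp_char:
  assumes x: "x \<in> carrier G"
  shows "(\<Sum>z\<in>carrier G. grp_char p m \<phi> z x) = (if x = \<one> then of_nat (card (carrier G)) else 0)"
proof (cases "x = \<one>")
  case True
  have "grp_char p m \<phi> z \<one> = 1" for z
    by (rule unitary_character.char_one[OF unitary_character_grp_char])
  then show ?thesis by (simp add: True)
next
  case False
  interpret X: unitary_character G "grp_char p m \<phi> x" by (rule unitary_character_grp_char)
  obtain y where y: "y \<in> carrier G" "grp_char p m \<phi> x y \<noteq> 1"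
    using grp_char_separates[OF x False] by blast
  let ?s = "\<Sum>z\<in>carrier G. grp_char p m \<phi> x z"
  have "?s = (\<Sum>z\<in>carrier G. grp_char p m \<phi> x (y \<otimes> z))"
    using y(1) surj_const_mult[OF y(1)] inj_on_cmult[OF y(1)]
    by (intro sum.reindex_cong[where l = "\<lambda>z. y \<otimes> z"]) auto
  also have "\<dots> = grp_char p m \<phi> x y * ?s"
    using y(1) by (simp add: X.char_mult sum_distrib_left)
  finally have "?s = 0" using y(2) by simp
  then show ?thesis using False by (simp add: grp_char_commute[of p m \<phi> _ x])
qed

text \<open>Fourier inversion recovers \<open>f y\<close>, up to the group order, from the
  coefficients. This is the sense in which the characters span.\<close>

lemma fourier_injective:
  fixes f :: "'a \<Rightarrow> complex"
  assumes zero: "\<And>k. k \<in> carrier G \<Longrightarrow> (\<Sum>x\<in>carrier G. cnj (grp_char p m \<phi> k x) * f x) = 0"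
    and y: "y \<in> carrier G"
  shows "f y = 0"
proof -
  have "0 = (\<Sum>k\<in>carrier G. grp_char p m \<phi> k y * (\<Sum>x\<in>carrier G. cnj (grp_char p m \<phi> k x) * f x))"
    by (simp add: zero)
  also have "\<dots> = (\<Sum>x\<in>carrier G. \<Sum>k\<in>carrier G. grp_char p m \<phi> k y * cnj (grp_char p m \<phi> k x) * f x)"
    by (subst sum.swap) (simp add: sum_distrib_left mult.assoc)
  also have "\<dots> = (\<Sum>x\<in>carrier G. (\<Sum>k\<in>carrier G. grp_char p m \<phi> k (y \<otimes> inv x)) * f x)"
    using y by (simp add: sum_distrib_right unitary_character.char_mult[OF unitary_character_grp_char]
        unitary_character.char_inv[OF unitary_character_grp_char])
  also have "\<dots> = (\<Sum>x\<in>carrier G. if x = y then of_nat (card (carrier G)) * f x else 0)"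
  proof (intro sum.cong refl)
    fix x assume x: "x \<in> carrier G"
    have "y \<otimes> inv x = \<one> \<longleftrightarrow> x = y"
      using x y inv_equality[of y "inv x"] by auto
    then show "(\<Sum>k\<in>carrier G. grp_char p m \<phi> k (y \<otimes> inv x)) * f x
        = (if x = y then of_nat (card (carrier G)) * f x else 0)"
      using x y by (simp add: sum_grp_char)
  qed
  also have "\<dots> = of_nat (card (carrier G)) * f y"
    using y finite_carrier by simp
  finally show ?thesis
    using y finite_carrier by (auto simp: card_eq_0_iff)
qed

end

section \<open>The blocks of a semi-Cayley graph\<close>

text \<open>The case \<open>u = v\<close> is covered as well: \<open>no_reverse_arc\<close> excludes
  loops, so the diagonal is zero.\<close>

lemma adj_matrix_skew:
  assumes "oriented_graph \<Gamma>"
  shows "adj_matrix \<Gamma> u v = - adj_matrix \<Gamma> v u"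
  using oriented_graph.no_reverse_arc[OF assms] by (auto simp: adj_matrix_def)

lemma pverts_osc_graph: "pverts (osc_graph G R L S) = carrier G \<times> {0, 1}"
  by (simp add: osc_graph_def)

lemma sum_vertices:
  "(\<Sum>w\<in>pverts (osc_graph G R L S). f w)
    = (\<Sum>h\<in>carrier G. f (h, 0)) + (\<Sum>h\<in>carrier G. f (h, 1))"
  by (simp add: pverts_osc_graph sum.cartesian_product' sum.distrib)

section \<open>Orthonormal eigenvectors of a skew-Hermitian matrix of size two\<close>

text \<open>Conjugating the first system shows that \<open>(cnj a, cnj b)\<close> is a left
  eigenvector for \<open>\<kappa>\<close>. Multiplying the matrix by it on the left and by
  \<open>(a', b')\<close> on the right gives the same product with factor \<open>\<kappa>\<close>
  and with factor \<open>\<mu>\<close>.\<close>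

lemma skew_hermitian_orthogonal:
  fixes r l s a b a' b' \<kappa> \<mu> :: complex
  assumes "cnj r = - r" "cnj l = - l" "cnj \<kappa> = - \<kappa>" "\<kappa> \<noteq> \<mu>"
    and x: "r * a + s * b = \<kappa> * a" "- cnj s * a + l * b = \<kappa> * b"
    and y: "r * a' + s * b' = \<mu> * a'" "- cnj s * a' + l * b' = \<mu> * b'"
  shows "cnj a * a' + cnj b * b' = 0"
proof -
  have "r * cnj a - cnj s * cnj b = \<kappa> * cnj a" "s * cnj a + l * cnj b = \<kappa> * cnj b"
    using arg_cong[OF x(1), of cnj] arg_cong[OF x(2), of cnj] assms(1-3)
    by (simp_all add: algebra_simps)
  then have "\<kappa> * (cnj a * a' + cnj b * b') = \<mu> * (cnj a * a' + cnj b * b')"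
    using y by algebra
  then show ?thesis using assms(4) by simp
qed

text \<open>The matrix with columns \<open>(a, b)\<close> and \<open>(a', b')\<close> is unitary, so
  its rows are orthonormal too. The equalities of moduli and the last identity express this.\<close>

lemma orthonormal_pair:
  fixes a b a' b' :: complex
  assumes "a * cnj a + b * cnj b = 1" "a' * cnj a' + b' * cnj b' = 1"
    and "cnj a * a' + cnj b * b' = 0" and "a \<noteq> 0" "a' \<noteq> 0"
  shows "b \<noteq> 0" "b' \<noteq> 0" "a' * cnj a' = b * cnj b" "b' * cnj b' = a * cnj a"
    and "a * cnj b + a' * cnj b' = 0"
proof -
  have conj: "a * cnj a' + b * cnj b' = 0"
    using arg_cong[OF assms(3), of cnj] by simp
  show b: "b \<noteq> 0" and b': "b' \<noteq> 0" using assms(3-5) by auto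
  show eq: "a' * cnj a' = b * cnj b" using assms(1-3) conj by algebra
  show eq': "b' * cnj b' = a * cnj a" using assms(1,2) eq by algebra
  \<comment> \<open>After replacing \<open>b' * cnj b'\<close> by \<open>a * cnj a\<close>, the left
    side is \<open>a\<close> times the inner product of the two columns.\<close>
  have "(a * cnj b + a' * cnj b') * b' = 0" using assms(3) eq' by algebra
  then show "a * cnj b + a' * cnj b' = 0" using b' by simp
qed

text \<open>These quotients appear when a pairing is divided by the first component of its
  eigenvector. Both become multiples of the inverse of the same \<open>cnj (a * cnj b)\<close>, the
  form used in condition (b).\<close>

lemma orthonormal_pair_ratios:
  fixes a b a' b' :: complex
  assumes "a * cnj a + b * cnj b = 1" "a' * cnj a' + b' * cnj b' = 1"
    and "cnj a * a' + cnj b * b' = 0" and "a \<noteq> 0" "a' \<noteq> 0"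
  shows "cnj b / cnj a = of_real ((cmod a')\<^sup>2) * inverse (cnj (a * cnj b))"
    and "cnj b' / cnj a' = - (of_real ((cmod a)\<^sup>2) * inverse (cnj (a * cnj b)))"
proof -
  note * = orthonormal_pair[OF assms]
  have "a * cnj a' + b * cnj b' = 0"
    using arg_cong[OF assms(3), of cnj] by simp
  then have "cnj b' = - (a * cnj a') / b"
    using *(1) by (simp add: field_simps eq_neg_iff_add_eq_0)
  then show "cnj b' / cnj a' = - (of_real ((cmod a)\<^sup>2) * inverse (cnj (a * cnj b)))"
    unfolding complex_norm_square using assms(4,5) *(1) by (simp add: field_simps)
  show "cnj b / cnj a = of_real ((cmod a')\<^sup>2) * inverse (cnj (a * cnj b))"
    unfolding complex_norm_square *(3) using assms(4) *(1) by (simp add: field_simps)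
qed

text \<open>Adding the squared moduli of both equations gives 1 on the left. On the right, row
  orthonormality reduces the coefficients of the two squares to 1 and cancels the mixed terms. The
  normalization of \<open>\<alpha>\<close> and \<open>\<beta>\<close> thus follows from condition
  (b), which does not state it.\<close>

lemma orthonormal_pair_sum_squares:
  fixes a b a' b' E E' w :: complex and \<alpha> \<beta> :: real
  assumes orth: "a * cnj a + b * cnj b = 1" "a' * cnj a' + b' * cnj b' = 1"
    "cnj a * a' + cnj b * b' = 0" "a \<noteq> 0" "a' \<noteq> 0"
    and "cmod E = 1" "cmod E' = 1" "cmod w = 1"
    and E: "E * cnj a = of_real \<alpha> * cnj a + of_real \<beta> * cnj b * w"
    and E': "E' * cnj a' = of_real \<alpha> * cnj a' + of_real \<beta> * cnj b' * w"
  shows "\<alpha>\<^sup>2 + \<beta>\<^sup>2 = 1"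
proof -
  note * = orthonormal_pair[OF orth]
  have unit: "z * cnj z = 1" if "cmod z = 1" for z
    using that complex_norm_square[of z] by simp
  have conj: "cnj a * b + cnj a' * b' = 0"
    using arg_cong[OF *(5), of cnj] by simp
  have "cnj E * a = of_real \<alpha> * a + of_real \<beta> * b * cnj w"
    "cnj E' * a' = of_real \<alpha> * a' + of_real \<beta> * b' * cnj w"
    using arg_cong[OF E, of cnj] arg_cong[OF E', of cnj] by simp_all
  with E E' have
    "(E * cnj a) * (cnj E * a) + (E' * cnj a') * (cnj E' * a') =
     (of_real \<alpha> * cnj a + of_real \<beta> * cnj b * w) * (of_real \<alpha> * a + of_real \<beta> * b * cnj w)
     + (of_real \<alpha> * cnj a' + of_real \<beta> * cnj b' * w) * (of_real \<alpha> * a' + of_real \<beta> * b' * cnj w)"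
    by simp
  moreover have "(E * cnj a) * (cnj E * a) + (E' * cnj a') * (cnj E' * a') = 1"
    using unit[OF assms(6)] unit[OF assms(7)] orth(1) *(3) by algebra
  ultimately have "(of_real \<alpha>)\<^sup>2 + (of_real \<beta>)\<^sup>2 = (1 :: complex)"
    using unit[OF assms(8)] orth(1,2) *(3,4,5) conj by algebra
  then have "complex_of_real (\<alpha>\<^sup>2 + \<beta>\<^sup>2) = of_real 1" by simp
  then show ?thesis by (simp only: of_real_eq_iff)
qed

lemma osc_block_eigenvector_iff:
  "osc_block G R L S \<psi> *v y = \<mu> *s y \<longleftrightarrow>
    skew_char_sum G \<psi> R * y $ 1 + char_sum \<psi> S * y $ 2 = \<mu> * y $ 1 \<and>
    - cnj (char_sum \<psi> S) * y $ 1 + skew_char_sum G \<psi> L * y $ 2 = \<mu> * y $ 2"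
  by (simp add: osc_block_def vec_eq_iff matrix_vector_mult_def sum_2 forall_2)

section \<open>Eigenvectors of the adjacency matrix and their pairings with the transition
  matrix\<close>

context unitary_character
begin

context
  fixes R L S :: "'a set"
  assumes sets: "R \<subseteq> carrier G" "L \<subseteq> carrier G" "S \<subseteq> carrier G"
    and oriented: "R \<inter> set_inv R = {}" "L \<inter> set_inv L = {}"
begin

text \<open>Disjointness of a connection set from its inverses turns the nested case distinction
  into a difference of indicators of translates, the shape summed by
  \<open>sum_translate_char\<close>.\<close>

lemma adj_matrix_osc_graph:
  assumes "g \<in> carrier G" "h \<in> carrier G"
  shows "adj_matrix (osc_graph G R L S) (g, 0) (h, 0) =
      of_bool (inv g \<otimes> h \<in> R) - of_bool (inv g \<otimes> h \<in> set_inv R)"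
    and "adj_matrix (osc_graph G R L S) (g, 1) (h, 1) =
      of_bool (inv g \<otimes> h \<in> L) - of_bool (inv g \<otimes> h \<in> set_inv L)"
    and "adj_matrix (osc_graph G R L S) (g, 0) (h, 1) = of_bool (inv g \<otimes> h \<in> S)"
    and "adj_matrix (osc_graph G R L S) (g, 1) (h, 0) = - of_bool (inv g \<otimes> h \<in> set_inv S)"
proof -
  have inv: "inv h \<otimes> g \<in> T \<longleftrightarrow> inv g \<otimes> h \<in> set_inv T" if "T \<subseteq> carrier G" for T
  proof
    assume "inv h \<otimes> g \<in> T"
    moreover have "inv g \<otimes> h = inv (inv h \<otimes> g)" using assms by (simp add: inv_mult_group)
    ultimately show "inv g \<otimes> h \<in> set_inv T" unfolding SET_INV_def by blast
  next
    assume "inv g \<otimes> h \<in> set_inv T"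
    then obtain y where y: "y \<in> T" "inv g \<otimes> h = inv y" unfolding SET_INV_def by blast
    have "inv h \<otimes> g = inv (inv g \<otimes> h)" using assms by (simp add: inv_mult_group)
    then have "inv h \<otimes> g = y" using y that by (simp add: subset_iff)
    then show "inv h \<otimes> g \<in> T" using y(1) by simp
  qed
  show "adj_matrix (osc_graph G R L S) (g, 0) (h, 0) =
      of_bool (inv g \<otimes> h \<in> R) - of_bool (inv g \<otimes> h \<in> set_inv R)"
    "adj_matrix (osc_graph G R L S) (g, 1) (h, 1) =
      of_bool (inv g \<otimes> h \<in> L) - of_bool (inv g \<otimes> h \<in> set_inv L)"
    "adj_matrix (osc_graph G R L S) (g, 0) (h, 1) = of_bool (inv g \<otimes> h \<in> S)"
    "adj_matrix (osc_graph G R L S) (g, 1) (h, 0) = - of_bool (inv g \<otimes> h \<in> set_inv S)"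
    using assms inv[OF sets(1)] inv[OF sets(2)] inv[OF sets(3)]
      disjoint_iff[THEN iffD1, OF oriented(1)] disjoint_iff[THEN iffD1, OF oriented(2)]
    by (simp_all add: adj_matrix_def osc_graph_def)
qed

text \<open>Each of the four blocks of the adjacency matrix acts on \<open>\<psi>\<close> as the
  corresponding scalar entry of \<open>osc_block\<close>, so the graph eigenvalue equation reduces
  to that of \<open>y\<close>.\<close>

lemma osc_graph_eigenvector:
  assumes eig: "osc_block G R L S \<psi> *v y = \<mu> *s y"
    and u: "u \<in> pverts (osc_graph G R L S)"
  defines "x \<equiv> \<lambda>(g, i). \<psi> g * (if i = (0::nat) then y $ 1 else y $ 2)"
  shows "(\<Sum>w\<in>pverts (osc_graph G R L S). of_real (adj_matrix (osc_graph G R L S) u w) * x w) = \<mu> * x u"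
proof -
  let ?A = "adj_matrix (osc_graph G R L S)"
  have row: "skew_char_sum G \<psi> R * y $ 1 + char_sum \<psi> S * y $ 2 = \<mu> * y $ 1"
    "- cnj (char_sum \<psi> S) * y $ 1 + skew_char_sum G \<psi> L * y $ 2 = \<mu> * y $ 2"
    using eig unfolding osc_block_eigenvector_iff by blast+
  have inv_sub: "set_inv T \<subseteq> carrier G" if "T \<subseteq> carrier G" for T
    using that by (auto simp: SET_INV_def)
  have of_bool: "complex_of_real (of_bool P) = of_bool P" for P
    by simp
  have block: "(\<Sum>h\<in>carrier G. of_real (?A (g, 0) (h, 0)) * \<psi> h) = \<psi> g * skew_char_sum G \<psi> R"
    "(\<Sum>h\<in>carrier G. of_real (?A (g, 1) (h, 1)) * \<psi> h) = \<psi> g * skew_char_sum G \<psi> L"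
    "(\<Sum>h\<in>carrier G. of_real (?A (g, 0) (h, 1)) * \<psi> h) = \<psi> g * char_sum \<psi> S"
    "(\<Sum>h\<in>carrier G. of_real (?A (g, 1) (h, 0)) * \<psi> h) = - (\<psi> g * cnj (char_sum \<psi> S))"
    if "g \<in> carrier G" for g
    using that sets of_bool
    by (simp_all add: adj_matrix_osc_graph inv_sub left_diff_distrib sum_subtractf sum_negf
        sum_translate_char skew_char_sum_def char_sum_set_inv right_diff_distrib del: One_nat_def)
  obtain g i where u_eq: "u = (g, i)" and g: "g \<in> carrier G" and i: "i = 0 \<or> i = 1"
    using u by (auto simp: osc_graph_def)
  have "(\<Sum>w\<in>pverts (osc_graph G R L S). of_real (?A u w) * x w)
      = (\<Sum>h\<in>carrier G. of_real (?A u (h, 0)) * \<psi> h) * y $ 1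
        + (\<Sum>h\<in>carrier G. of_real (?A u (h, 1)) * \<psi> h) * y $ 2"
    unfolding sum_vertices by (simp add: x_def sum_distrib_right mult.assoc)
  also have "\<dots> = \<psi> g * (if i = 0 then skew_char_sum G \<psi> R * y $ 1 + char_sum \<psi> S * y $ 2
      else - cnj (char_sum \<psi> S) * y $ 1 + skew_char_sum G \<psi> L * y $ 2)"
    by (rule disjE[OF i]; simp add: u_eq block[OF g] del: One_nat_def; simp add: algebra_simps)
  also have "\<dots> = \<psi> g * (if i = 0 then \<mu> * y $ 1 else \<mu> * y $ 2)"
    by (simp only: row)
  also have "\<dots> = \<mu> * x u"
    by (simp add: u_eq x_def)
  finally show ?thesis .
qed

lemma cnj_osc_lambda:
  "cnj (osc_lambda_plus G R L S \<psi>) = - osc_lambda_plus G R L S \<psi>"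
  "cnj (osc_lambda_minus G R L S \<psi>) = - osc_lambda_minus G R L S \<psi>"
  using sets
  by (simp_all add: osc_lambda_plus_def osc_lambda_minus_def cnj_skew_char_sum field_simps)

text \<open>The difference of the diagonal entries is imaginary, so its square is at most 0, and
  subtracting a positive number leaves a nonzero radicand.\<close>

lemma osc_lambda_distinct:
  assumes "char_sum \<psi> S \<noteq> 0"
  shows "osc_lambda_plus G R L S \<psi> \<noteq> osc_lambda_minus G R L S \<psi>"
proof -
  define d where "d = skew_char_sum G \<psi> L - skew_char_sum G \<psi> R"
  define q where "q = (cmod (char_sum \<psi> S))\<^sup>2"
  have "cnj d = - d" using sets by (simp add: d_def cnj_skew_char_sum)
  then have "Re d = 0" by (simp add: complex_eq_iff)
  then have "Re (d\<^sup>2) \<le> 0" by (simp add: power2_eq_square)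
  moreover have "q > 0" using assms by (simp add: q_def)
  ultimately have "Re (d\<^sup>2 - 4 * of_real q) < 0" by simp
  then have "d\<^sup>2 - 4 * of_real q \<noteq> 0" by force
  then have "osc_gap G R L S \<psi> \<noteq> 0" by (simp add: osc_gap_def d_def q_def)
  moreover have "osc_lambda_plus G R L S \<psi> - osc_lambda_minus G R L S \<psi> = \<i> * of_real (osc_gap G R L S \<psi>)"
    using assms unfolding osc_lambda_plus_def osc_lambda_minus_def
    by (simp add: diff_divide_distrib[symmetric])
  ultimately show ?thesis by auto
qed

text \<open>A vanishing first component would force the second to vanish through the nonzero upper
  right entry. Orthogonality needs only that the eigenvalues are imaginary and distinct, not their
  formula.\<close>

lemma osc_block_eigenvectors:
  assumes "char_sum \<psi> S \<noteq> 0"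
    and x: "normalized_eigenvector (osc_block G R L S \<psi>) (osc_lambda_plus G R L S \<psi>) x"
    and y: "normalized_eigenvector (osc_block G R L S \<psi>) (osc_lambda_minus G R L S \<psi>) y"
  shows "x $ 1 \<noteq> 0" "y $ 1 \<noteq> 0" "cnj (x $ 1) * y $ 1 + cnj (x $ 2) * y $ 2 = 0"
proof -
  have first: "z $ 1 \<noteq> 0" if "normalized_eigenvector (osc_block G R L S \<psi>) \<mu> z" for \<mu> z
  proof
    assume "z $ 1 = 0"
    moreover from this have "z $ 2 = 0"
      using that assms(1) by (simp add: normalized_eigenvector_def osc_block_eigenvector_iff)
    ultimately have "z = 0" by (simp add: vec_eq_iff forall_2)
    then show False using that by (simp add: normalized_eigenvector_def)
  qed
  show "x $ 1 \<noteq> 0" "y $ 1 \<noteq> 0" using first x y by blast+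
  have rows: "skew_char_sum G \<psi> R * z $ 1 + char_sum \<psi> S * z $ 2 = \<mu> * z $ 1"
    "- cnj (char_sum \<psi> S) * z $ 1 + skew_char_sum G \<psi> L * z $ 2 = \<mu> * z $ 2"
    if "normalized_eigenvector (osc_block G R L S \<psi>) \<mu> z" for \<mu> z
    using that unfolding normalized_eigenvector_def osc_block_eigenvector_iff by blast+
  show "cnj (x $ 1) * y $ 1 + cnj (x $ 2) * y $ 2 = 0"
    by (rule skew_hermitian_orthogonal[OF cnj_skew_char_sum[OF sets(1)]
          cnj_skew_char_sum[OF sets(2)] cnj_osc_lambda(1) osc_lambda_distinct[OF assms(1)]
          rows[OF x] rows[OF y]])
qed

text \<open>For a real skew-symmetric matrix, conjugating a right eigenvector for
  \<open>\<mu>\<close> gives a left eigenvector for \<open>- cnj \<mu>\<close>, which is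
  \<open>\<mu>\<close> itself here.\<close>

lemma transition_matrix_pairing:
  assumes eig: "osc_block G R L S \<psi> *v y = \<mu> *s y" and \<mu>: "cnj \<mu> = - \<mu>"
    and u: "u \<in> pverts (osc_graph G R L S)"
  defines "x \<equiv> \<lambda>(g, i). \<psi> g * (if i = (0::nat) then y $ 1 else y $ 2)"
  shows "(\<Sum>w\<in>pverts (osc_graph G R L S). cnj (x w) *
      of_real (transition_matrix (osc_graph G R L S) t w u)) = exp (of_real t * \<mu>) * cnj (x u)"
  unfolding transition_matrix_def
proof (rule left_eigenvector_matrix_exp)
  let ?\<Gamma> = "osc_graph G R L S"
  show "finite (pverts ?\<Gamma>)" using finite_carrier by (simp add: pverts_osc_graph)
  show "u \<in> pverts ?\<Gamma>" by (rule u)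
  fix w assume w: "w \<in> pverts ?\<Gamma>"
  have "oriented_graph ?\<Gamma>"
    using osc_graph_oriented is_group finite_carrier oriented by blast
  then have skew: "adj_matrix ?\<Gamma> z w = - adj_matrix ?\<Gamma> w z" for z
    by (rule adj_matrix_skew)
  have "(\<Sum>z\<in>pverts ?\<Gamma>. cnj (x z) * of_real (adj_matrix ?\<Gamma> z w * t))
      = - of_real t * cnj (\<Sum>z\<in>pverts ?\<Gamma>. of_real (adj_matrix ?\<Gamma> w z) * x z)"
    unfolding cnj_sum sum_distrib_left by (intro sum.cong refl) (simp add: skew)
  also have "\<dots> = - of_real t * cnj (\<mu> * x w)"
    using osc_graph_eigenvector[OF eig w] by (simp only: x_def)
  finally show "(\<Sum>z\<in>pverts ?\<Gamma>. cnj (x z) * of_real (adj_matrix ?\<Gamma> z w * t))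
      = of_real t * \<mu> * cnj (x w)"
    by (simp add: \<mu>)
qed

text \<open>\<open>f\<close> is the error in the revival equation. Its pairing with
  \<open>\<psi> \<otimes> y\<close> is split into the Fourier coefficients on the two layers, so
  that different \<open>y\<close> for the same character give linear equations in the same two
  unknowns.\<close>

lemma revival_defect:
  fixes g h :: 'a and \<alpha> \<beta> t :: real
  assumes gh: "g \<in> carrier G" "h \<in> carrier G"
    and eig: "osc_block G R L S \<psi> *v y = \<mu> *s y" and \<mu>: "cnj \<mu> = - \<mu>"
  defines "f \<equiv> \<lambda>w. transition_matrix (osc_graph G R L S) t w (g, 0)
      - (\<alpha> * unit_vector (g, 0) w + \<beta> * unit_vector (h, 1) w)"
  shows "cnj (y $ 1) * (\<Sum>x\<in>carrier G. cnj (\<psi> x) * of_real (f (x, 0)))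
      + cnj (y $ 2) * (\<Sum>x\<in>carrier G. cnj (\<psi> x) * of_real (f (x, 1)))
    = cnj (\<psi> g) * ((exp (of_real t * \<mu>) - of_real \<alpha>) * cnj (y $ 1)
        - of_real \<beta> * cnj (y $ 2) * cnj (\<psi> (inv g \<otimes> h)))"
proof -
  let ?V = "pverts (osc_graph G R L S)"
  define x where "x = (\<lambda>(g, i). \<psi> g * (if i = (0::nat) then y $ 1 else y $ 2))"
  have V: "finite ?V" "(g, 0) \<in> ?V" "(h, 1) \<in> ?V"
    using gh finite_carrier by (simp_all add: pverts_osc_graph)
  have unit: "(\<Sum>w\<in>?V. cnj (x w) * of_real (unit_vector u w)) = cnj (x u)" if "u \<in> ?V" for u
  proof -
    have "(\<Sum>w\<in>?V. cnj (x w) * of_real (unit_vector u w)) = (\<Sum>w\<in>?V. if w = u then cnj (x w) else 0)"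
      by (intro sum.cong) (auto simp: unit_vector_def)
    then show ?thesis using that V(1) by simp
  qed
  have "cnj (y $ 1) * (\<Sum>x\<in>carrier G. cnj (\<psi> x) * of_real (f (x, 0)))
      + cnj (y $ 2) * (\<Sum>x\<in>carrier G. cnj (\<psi> x) * of_real (f (x, 1)))
      = (\<Sum>w\<in>?V. cnj (x w) * of_real (f w))"
    unfolding sum_vertices sum_distrib_left by (simp add: x_def algebra_simps)
  also have "\<dots> = (\<Sum>w\<in>?V. cnj (x w) * of_real (transition_matrix (osc_graph G R L S) t w (g, 0)))
      - (of_real \<alpha> * (\<Sum>w\<in>?V. cnj (x w) * of_real (unit_vector (g, 0) w))
        + of_real \<beta> * (\<Sum>w\<in>?V. cnj (x w) * of_real (unit_vector (h, 1) w)))"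
    unfolding sum_distrib_left sum.distrib[symmetric] sum_subtractf[symmetric]
    by (intro sum.cong refl) (simp add: f_def algebra_simps)
  also have "\<dots> = exp (of_real t * \<mu>) * cnj (x (g, 0))
      - (of_real \<alpha> * cnj (x (g, 0)) + of_real \<beta> * cnj (x (h, 1)))"
    unfolding unit[OF V(2)] unit[OF V(3)]
    using transition_matrix_pairing[OF eig \<mu> V(2)] by (simp only: x_def)
  also have "x (g, 0) = \<psi> g * y $ 1" by (simp add: x_def)
  \<comment> \<open>Writing \<open>h\<close> as \<open>g\<close> times
    \<open>inv g \<otimes> h\<close> exposes the common factor \<open>\<psi> g\<close>.\<close>
  also have "x (h, 1) = \<psi> g * \<psi> (inv g \<otimes> h) * y $ 2"
    using gh char_mult[of g "inv g \<otimes> h"] by (simp add: x_def m_assoc[symmetric])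
  finally show ?thesis by (simp add: algebra_simps)
qed

end

end


section \<open>Fractional revival in terms of the pairings\<close>

theorem theorem4p5:
  fixes G :: "('a, 'b) monoid_scheme"
    and R L S :: "'a set"
    and n p :: nat and m :: "nat \<Rightarrow> nat" and \<phi> :: "'a \<Rightarrow> nat \<Rightarrow> int"
    and vplus vminus :: "'a \<Rightarrow> complex^2"
    and g h :: 'a and \<alpha> \<beta> t :: real
  assumes G: "comm_group G" "finite (carrier G)" "order G = n"
    and decomposition: "\<forall>s\<in>{1..p}. m s \<ge> 1" "\<phi> \<in> iso G (cyclic_sum_group p m)"
    and connection_sets: "R \<subseteq> carrier G" "L \<subseteq> carrier G" "S \<subseteq> carrier G"
    and oriented: "R \<inter> set_inv\<^bsub>G\<^esub> R = {}" "L \<inter> set_inv\<^bsub>G\<^esub> L = {}" "\<one>\<^bsub>G\<^esub> \<notin> R \<union> L"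
    and eigenvectors:
      "\<forall>k\<in>carrier G. normalized_eigenvector (osc_block G R L S (grp_char p m \<phi> k))
         (osc_lambda_plus G R L S (grp_char p m \<phi> k)) (vplus k)"
      "\<forall>k\<in>carrier G. normalized_eigenvector (osc_block G R L S (grp_char p m \<phi> k))
         (osc_lambda_minus G R L S (grp_char p m \<phi> k)) (vminus k)"
    and convention:
      "\<forall>k\<in>carrier G. char_sum (grp_char p m \<phi> k) S = 0 \<longrightarrow>
         vplus k = vector [1, 0] \<and> vminus k = vector [0, 1]"
    and gh: "g \<in> carrier G" "h \<in> carrier G"
    and nonzero: "\<alpha> \<noteq> 0" "\<beta> \<noteq> 0"
  shows "admits_FR (osc_graph G R L S) \<alpha> \<beta> (g, 0) (h, 1) t \<longleftrightarrow>
     {k \<in> carrier G. char_sum (grp_char p m \<phi> k) S = 0} = {} \<and>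
     (let a = inv\<^bsub>G\<^esub> g \<otimes>\<^bsub>G\<^esub> h in
      \<forall>k\<in>carrier G.
        exp (of_real t * osc_lambda_plus G R L S (grp_char p m \<phi> k)) =
          of_real \<alpha> + of_real \<beta> * of_real (eig_c (vminus k)) *
            inverse (cnj (eig_e (vplus k))) * cnj (grp_char p m \<phi> k a) \<and>
        exp (of_real t * osc_lambda_minus G R L S (grp_char p m \<phi> k)) =
          of_real \<alpha> - of_real \<beta> * of_real (eig_c (vplus k)) *
            inverse (cnj (eig_e (vplus k))) * cnj (grp_char p m \<phi> k a))"
proof -
  interpret cyclic_decomposition G p m \<phi>
    using G decomposition by (auto simp: cyclic_decomposition_def cyclic_decomposition_axioms_def)
  let ?\<Gamma> = "osc_graph G R L S"
  let ?\<chi> = "grp_char p m \<phi>"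
  let ?a = "inv\<^bsub>G\<^esub> g \<otimes>\<^bsub>G\<^esub> h"
  let ?plus = "\<lambda>k. osc_lambda_plus G R L S (?\<chi> k)"
  let ?minus = "\<lambda>k. osc_lambda_minus G R L S (?\<chi> k)"
  have char: "unitary_character G (?\<chi> k)" for k
    by (rule unitary_character_grp_char)
  note sets = connection_sets oriented(1,2)
  define f where "f = (\<lambda>w. transition_matrix ?\<Gamma> t w (g, 0)
      - (\<alpha> * unit_vector (g, 0) w + \<beta> * unit_vector (h, 1) w))"
  \<comment> \<open>\<open>F k i\<close> is the Fourier coefficient of the revival error on layer
    \<open>i\<close> at the character labelled \<open>k\<close>.\<close>
  define F where "F = (\<lambda>k i. \<Sum>x\<in>carrier G. cnj (?\<chi> k x) * complex_of_real (f (x, i :: nat)))"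
  define pairing where "pairing = (\<lambda>k \<mu> (x :: complex^2).
      exp (of_real t * \<mu>) * cnj (x $ 1) =
      of_real \<alpha> * cnj (x $ 1) + of_real \<beta> * cnj (x $ 2) * cnj (?\<chi> k ?a))"
  have a: "?a \<in> carrier G" using gh by simp
  have eig: "osc_block G R L S (?\<chi> k) *v vplus k = ?plus k *s vplus k"
    "osc_block G R L S (?\<chi> k) *v vminus k = ?minus k *s vminus k"
    if "k \<in> carrier G" for k
    using eigenvectors that by (simp_all add: normalized_eigenvector_def)
  have defect: "pairing k \<mu> x \<longleftrightarrow> cnj (x $ 1) * F k 0 + cnj (x $ 2) * F k 1 = 0"
    if "osc_block G R L S (?\<chi> k) *v x = \<mu> *s x" "cnj \<mu> = - \<mu>" for k \<mu> x
  proof -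
    have "cnj (x $ 1) * F k 0 + cnj (x $ 2) * F k 1 = cnj (?\<chi> k g) *
        ((exp (of_real t * \<mu>) - of_real \<alpha>) * cnj (x $ 1) - of_real \<beta> * cnj (x $ 2) * cnj (?\<chi> k ?a))"
      unfolding F_def f_def by (rule unitary_character.revival_defect[OF char sets gh that])
    moreover have "?\<chi> k g \<noteq> 0" by (rule unitary_character.char_nonzero[OF char gh(1)])
    moreover have "pairing k \<mu> x \<longleftrightarrow>
        (exp (of_real t * \<mu>) - of_real \<alpha>) * cnj (x $ 1) - of_real \<beta> * cnj (x $ 2) * cnj (?\<chi> k ?a) = 0"
      by (auto simp: pairing_def algebra_simps)
    ultimately show ?thesis by simp
  qed
  note imaginary = unitary_character.cnj_osc_lambda[OF char sets]
  have orth: "vplus k $ 1 * cnj (vplus k $ 1) + vplus k $ 2 * cnj (vplus k $ 2) = 1"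
    "vminus k $ 1 * cnj (vminus k $ 1) + vminus k $ 2 * cnj (vminus k $ 2) = 1"
    "cnj (vplus k $ 1) * vminus k $ 1 + cnj (vplus k $ 2) * vminus k $ 2 = 0"
    "vplus k $ 1 \<noteq> 0" "vminus k $ 1 \<noteq> 0"
    if k: "k \<in> carrier G" and S: "char_sum (?\<chi> k) S \<noteq> 0" for k
  proof -
    have norm: "x $ 1 * cnj (x $ 1) + x $ 2 * cnj (x $ 2) = 1" if "norm x = 1" for x :: "complex^2"
    proof -
      have "(cmod (x $ 1))\<^sup>2 + (cmod (x $ 2))\<^sup>2 = 1"
        using that by (simp add: norm_vec_def L2_set_def sum_2)
      then have "complex_of_real ((cmod (x $ 1))\<^sup>2 + (cmod (x $ 2))\<^sup>2) = 1" by simp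
      then show ?thesis by (simp only: of_real_add complex_norm_square)
    qed
    show "vplus k $ 1 * cnj (vplus k $ 1) + vplus k $ 2 * cnj (vplus k $ 2) = 1"
      "vminus k $ 1 * cnj (vminus k $ 1) + vminus k $ 2 * cnj (vminus k $ 2) = 1"
      using eigenvectors k norm by (simp_all add: normalized_eigenvector_def)
    show "cnj (vplus k $ 1) * vminus k $ 1 + cnj (vplus k $ 2) * vminus k $ 2 = 0"
      "vplus k $ 1 \<noteq> 0" "vminus k $ 1 \<noteq> 0"
      using unitary_character.osc_block_eigenvectors[OF char sets S] eigenvectors k by blast+
  qed
  have pairing_iff: "pairing k (?plus k) (vplus k) \<longleftrightarrow>
      exp (of_real t * ?plus k) = of_real \<alpha> + of_real \<beta> * of_real (eig_c (vminus k)) *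
        inverse (cnj (eig_e (vplus k))) * cnj (?\<chi> k ?a)" (is ?thesis1)
    "pairing k (?minus k) (vminus k) \<longleftrightarrow>
      exp (of_real t * ?minus k) = of_real \<alpha> - of_real \<beta> * of_real (eig_c (vplus k)) *
        inverse (cnj (eig_e (vplus k))) * cnj (?\<chi> k ?a)" (is ?thesis2)
    if k: "k \<in> carrier G" "char_sum (?\<chi> k) S \<noteq> 0" for k
  proof -
    note ratios = orthonormal_pair_ratios[OF orth[OF k], folded eig_c_def eig_e_def]
    \<comment> \<open>Dividing by the nonzero first component solves the pairing for the
      exponential; the ratio identities then give the form of (b).\<close>
    have divide: "pairing k \<mu> x \<longleftrightarrow> exp (of_real t * \<mu>) =
        of_real \<alpha> + of_real \<beta> * (cnj (x $ 2) / cnj (x $ 1)) * cnj (?\<chi> k ?a)"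
      if "x $ 1 \<noteq> 0" for \<mu> x
      using that by (simp add: pairing_def field_simps)
    show ?thesis1 by (simp add: divide[OF orth(4)[OF k]] ratios mult.assoc)
    show ?thesis2 by (simp add: divide[OF orth(5)[OF k]] ratios mult.assoc)
  qed
  have FR_iff: "admits_FR ?\<Gamma> \<alpha> \<beta> (g, 0) (h, 1) t \<longleftrightarrow>
      \<alpha>\<^sup>2 + \<beta>\<^sup>2 = 1 \<and> (\<forall>x\<in>carrier G. \<forall>i\<in>{0, 1}. f (x, i) = 0)"
  proof -
    have "finite (pverts ?\<Gamma>)" "(g, 0) \<in> pverts ?\<Gamma>" "(h, 1) \<in> pverts ?\<Gamma>"
      using finite_carrier gh by (simp_all add: pverts_osc_graph)
    then show ?thesis
      using nonzero(2) by (auto simp: admits_FR_def matrix_apply_unit_vector f_def pverts_osc_graph)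
  qed
  show ?thesis
    unfolding Let_def
  proof (intro iffI conjI ballI)
    assume FR: "admits_FR ?\<Gamma> \<alpha> \<beta> (g, 0) (h, 1) t"
    then have F: "F k 0 = 0" "F k 1 = 0" for k
      unfolding FR_iff F_def by simp_all
    have pairing: "pairing k (?plus k) (vplus k)" "pairing k (?minus k) (vminus k)"
      if "k \<in> carrier G" for k
      using defect[OF eig(1)[OF that] imaginary(1)] defect[OF eig(2)[OF that] imaginary(2)] F
      by simp_all
    \<comment> \<open>For the conventional eigenvector \<open>(0, 1)\<close> the terms with the
      exponential and with \<open>\<alpha>\<close> drop out, leaving \<open>\<beta>\<close> times a
      nonzero character value.\<close>
    have S: "char_sum (?\<chi> k) S \<noteq> 0" if k: "k \<in> carrier G" for k
    proof
      assume "char_sum (?\<chi> k) S = 0"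
      then have "vminus k = vector [0, 1]" using convention k by blast
      then have "of_real \<beta> * cnj (?\<chi> k ?a) = 0"
        using pairing(2)[OF k] by (simp add: pairing_def)
      then show False
        using nonzero(2) unitary_character.char_nonzero[OF char a] by simp
    qed
    then show "{k \<in> carrier G. char_sum (?\<chi> k) S = 0} = {}" by blast
    fix k assume k: "k \<in> carrier G"
    show "exp (of_real t * ?plus k) = of_real \<alpha> + of_real \<beta> * of_real (eig_c (vminus k)) *
        inverse (cnj (eig_e (vplus k))) * cnj (?\<chi> k ?a)"
      using pairing(1)[OF k] pairing_iff(1)[OF k S[OF k]] by blast
    show "exp (of_real t * ?minus k) = of_real \<alpha> - of_real \<beta> * of_real (eig_c (vplus k)) *
        inverse (cnj (eig_e (vplus k))) * cnj (?\<chi> k ?a)"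
      using pairing(2)[OF k] pairing_iff(2)[OF k S[OF k]] by blast
  next
    assume conditions: "{k \<in> carrier G. char_sum (?\<chi> k) S = 0} = {} \<and>
      (\<forall>k\<in>carrier G.
        exp (of_real t * ?plus k) = of_real \<alpha> + of_real \<beta> * of_real (eig_c (vminus k)) *
          inverse (cnj (eig_e (vplus k))) * cnj (?\<chi> k ?a) \<and>
        exp (of_real t * ?minus k) = of_real \<alpha> - of_real \<beta> * of_real (eig_c (vplus k)) *
          inverse (cnj (eig_e (vplus k))) * cnj (?\<chi> k ?a))"
    then have S: "char_sum (?\<chi> k) S \<noteq> 0" if "k \<in> carrier G" for k
      using that by blast
    have pairing: "pairing k (?plus k) (vplus k)" "pairing k (?minus k) (vminus k)"
      if "k \<in> carrier G" for k
      using conditions that pairing_iff[OF that S[OF that]] by blast+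
    \<comment> \<open>The two pairings form a homogeneous system whose matrix is unitary, since the
      eigenvectors are orthonormal; only the zero solution remains.\<close>
    have F: "F k 0 = 0 \<and> F k 1 = 0" if k: "k \<in> carrier G" for k
    proof -
      let ?x = "vplus k" and ?y = "vminus k"
      have "cnj (?x $ 1) * F k 0 + cnj (?x $ 2) * F k 1 = 0"
        "cnj (?y $ 1) * F k 0 + cnj (?y $ 2) * F k 1 = 0"
        using defect[OF eig(1)[OF k] imaginary(1)] defect[OF eig(2)[OF k] imaginary(2)]
          pairing[OF k] by blast+
      then show ?thesis
        using orth(1,2,3)[OF k S[OF k]] orthonormal_pair(5)[OF orth[OF k S[OF k]]]
          orthonormal_pair(3,4)[OF orth[OF k S[OF k]]] by algebra
    qed
    have "f (x, i) = 0" if "x \<in> carrier G" "i \<in> {0, 1}" for x i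
    proof -
      have "complex_of_real (f (x, i)) = 0"
        using F that by (intro fourier_injective[of "\<lambda>x. of_real (f (x, i))"]) (auto simp: F_def)
      then show ?thesis by simp
    qed
    moreover have "\<alpha>\<^sup>2 + \<beta>\<^sup>2 = 1"
    \<comment> \<open>The equation does not involve \<open>k\<close>, so one label suffices; the
      identity is always available.\<close>
    proof (rule orthonormal_pair_sum_squares[OF orth[OF one_closed S[OF one_closed]]])
      have norm: "cmod (exp (of_real t * \<mu>)) = 1" if "cnj \<mu> = - \<mu>" for \<mu>
        using that by (simp add: complex_eq_iff)
      show "cmod (exp (of_real t * ?plus \<one>\<^bsub>G\<^esub>)) = 1" "cmod (exp (of_real t * ?minus \<one>\<^bsub>G\<^esub>)) = 1"
        by (intro norm imaginary)+
      show "cmod (cnj (?\<chi> \<one>\<^bsub>G\<^esub> ?a)) = 1"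
        using unitary_character.norm_char[OF char a] by simp
    qed (use pairing[OF one_closed] in \<open>simp_all add: pairing_def\<close>)
    ultimately show "admits_FR ?\<Gamma> \<alpha> \<beta> (g, 0) (h, 1) t"
      unfolding FR_iff by blast
  qed
qed

end
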